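(* Let $\Omega\subset\mathbb{H}$ be a symmetric slice domain. Given $I_{0}\in\mathbb{S}$ and $f,g\in\mathcal{S}(\Omega)$, the following are equivalent: (i) the $*$-product $f*g$ belongs to $\mathcal{S}_{I_{0}}(\Omega)$; (ii) $\langle f, M_{0}*g^c\rangle_{*}\equiv 0$ for all $M_{0}\in\mathbb{S}$ orthogonal to $I_0$; (iii) $\langle f^{c}, g*M_{0}\rangle_{*}\equiv 0$ for all $M_{0}\in\mathbb{S}$ orthogonal to $I_0$.
   Context: $\mathbb{H}$ is the algebra of quaternions with standard basis $1,i,j,k$, $\mathrm{Im}\,\mathbb{H}=\mathrm{Span}_{\mathbb{R}}(i,j,k)\simeq\mathbb{R}^3$ (Euclidean), $\mathbb{S}=\{q\in\mathbb{H}: q^2=-1\}\subset\mathrm{Im}\,\mathbb{H}$, and $\mathbb{C}_I=\mathrm{Span}_{\mathbb{R}}(1,I)$ for $I\in\mathbb{S}$. A symmetric slice domain $\Omega\subset\mathbb{H}$ is a domain (connected open set) such that $\Omega\cap\mathbb{R}\neq\emptyset$ and, whenever $\alpha+I\beta\in\Omega$ ($\alpha,\beta\in\mathbb{R}$, $I\in\mathbb{S}$), also $\alpha+J\beta\in\Omega$ for all $J\in\mathbb{S}$. A function $f:\Omega\to\mathbb{H}$ is slice regular if for every $J\in\mathbb{S}$ the restriction $f_J$ of $f$ to $\Omega\cap\mathbb{C}_J$ is holomorphic: $\frac12\left(\frac{\partial}{\partial\alpha}+J\frac{\partial}{\partial\beta}\right)f_J(\alpha+J\beta)\equiv0$. $\mathcal{S}(\Omega)$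 is the set of slice regular functions on $\Omega$; $\mathcal{S}_{\mathbb{R}}(\Omega)$ is the subset of slice preserving functions, i.e. $f(\Omega\cap\mathbb{C}_I)\subset\mathbb{C}_I$ for all $I\in\mathbb{S}$; $\mathcal{S}_{J}(\Omega)$ is the set of $f\in\mathcal{S}(\Omega)$ with $f(\Omega\cap\mathbb{C}_J)\subset\mathbb{C}_J$. Known fact: every $f\in\mathcal{S}(\Omega)$ is written uniquely as $f=f_0+f_1i+f_2j+f_3k$ with $f_0,\dots,f_3\in\mathcal{S}_{\mathbb{R}}(\Omega)$. The regular conjugate is $f^c=f_0-f_1i-f_2j-f_3k$. The $*$-product is $f*g=f_0g_0-f_1g_1-f_2g_2-f_3g_3+f_0(g_1i+g_2j+g_3k)+g_0(f_1i+f_2j+f_3k)+(f_2g_3-f_3g_2)i+(f_3g_1-f_1g_3)j+(f_1g_2-f_2g_1)k$ (pointwise products). Quaternions are regarded as constant slice regular functions. $\langle f,g\rangle_*=(f*g^c)_0=f_0g_0+f_1g_1+f_2g_2+f_3g_3$. *)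

theory Defs
  imports "HOL-Analysis.Analysis"
begin

section \<open>The quaternions\<close>

codatatype quat = Quat (Re0: real) (Im1: real) (Im2: real) (Im3: real)

lemma quat_eq_iff: "x = y \<longleftrightarrow> Re0 x = Re0 y \<and> Im1 x = Im1 y \<and> Im2 x = Im2 y \<and> Im3 x = Im3 y"
  by (auto intro: quat.expand)

lemma quat_eqI:
  "Re0 x = Re0 y \<Longrightarrow> Im1 x = Im1 y \<Longrightarrow> Im2 x = Im2 y \<Longrightarrow> Im3 x = Im3 y \<Longrightarrow> x = y"
  by (simp add: quat_eq_iff)

instantiation quat :: ab_group_add
begin

primcorec zero_quat where
  "Re0 0 = 0" | "Im1 0 = 0" | "Im2 0 = 0" | "Im3 0 = 0"

primcorec plus_quat where
  "Re0 (x + y) = Re0 x + Re0 y"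
| "Im1 (x + y) = Im1 x + Im1 y"
| "Im2 (x + y) = Im2 x + Im2 y"
| "Im3 (x + y) = Im3 x + Im3 y"

primcorec uminus_quat where
  "Re0 (- x) = - Re0 x"
| "Im1 (- x) = - Im1 x"
| "Im2 (- x) = - Im2 x"
| "Im3 (- x) = - Im3 x"

primcorec minus_quat where
  "Re0 (x - y) = Re0 x - Re0 y"
| "Im1 (x - y) = Im1 x - Im1 y"
| "Im2 (x - y) = Im2 x - Im2 y"
| "Im3 (x - y) = Im3 x - Im3 y"

instance
  by standard (simp_all add: quat_eq_iff)

end

instantiation quat :: real_vector
begin

primcorec scaleR_quat where
  "Re0 (r *\<^sub>R x) = r * Re0 x"
| "Im1 (r *\<^sub>R x) = r * Im1 x"
| "Im2 (r *\<^sub>R x) = r * Im2 x"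
| "Im3 (r *\<^sub>R x) = r * Im3 x"

instance
  by standard (auto simp: quat_eq_iff algebra_simps)

end

instantiation quat :: real_algebra_1
begin

primcorec one_quat where
  "Re0 1 = 1" | "Im1 1 = 0" | "Im2 1 = 0" | "Im3 1 = 0"

primcorec times_quat where
  "Re0 (x * y) = Re0 x * Re0 y - Im1 x * Im1 y - Im2 x * Im2 y - Im3 x * Im3 y"
| "Im1 (x * y) = Re0 x * Im1 y + Im1 x * Re0 y + Im2 x * Im3 y - Im3 x * Im2 y"
| "Im2 (x * y) = Re0 x * Im2 y - Im1 x * Im3 y + Im2 x * Re0 y + Im3 x * Im1 y"
| "Im3 (x * y) = Re0 x * Im3 y + Im1 x * Im2 y - Im2 x * Im1 y + Im3 x * Re0 y"

instance
  by standard (auto simp: quat_eq_iff algebra_simps)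

end

lemma quat_norm2_pos:
  assumes "x \<noteq> 0"
  shows "0 < (Re0 x)\<^sup>2 + (Im1 x)\<^sup>2 + (Im2 x)\<^sup>2 + (Im3 x)\<^sup>2"
proof -
  have "Re0 x \<noteq> 0 \<or> Im1 x \<noteq> 0 \<or> Im2 x \<noteq> 0 \<or> Im3 x \<noteq> 0"
    using assms by (auto simp: quat_eq_iff)
  then show ?thesis
    by (smt (verit) zero_le_power2 zero_less_power2)
qed

instantiation quat :: real_div_algebra
begin

definition inverse_quat :: "quat \<Rightarrow> quat" where
  "inverse x = (1 / ((Re0 x)\<^sup>2 + (Im1 x)\<^sup>2 + (Im2 x)\<^sup>2 + (Im3 x)\<^sup>2))
                 *\<^sub>R Quat (Re0 x) (- Im1 x) (- Im2 x) (- Im3 x)"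

definition "x div y = x * inverse y" for x y :: quat

instance
proof
  fix x y :: quat
  let ?n = "(Re0 x)\<^sup>2 + (Im1 x)\<^sup>2 + (Im2 x)\<^sup>2 + (Im3 x)\<^sup>2"
  let ?c = "Quat (Re0 x) (- Im1 x) (- Im2 x) (- Im3 x)"
  have "?c * x = ?n *\<^sub>R 1" "x * ?c = ?n *\<^sub>R 1"
    by (simp_all add: quat_eq_iff power2_eq_square)
  then show "x \<noteq> 0 \<Longrightarrow> inverse x * x = 1" "x \<noteq> 0 \<Longrightarrow> x * inverse x = 1"
    using quat_norm2_pos[of x] by (simp_all add: inverse_quat_def)
  show "x div y = x * inverse y" by (simp add: divide_quat_def)
  show "inverse (0 :: quat) = 0" by (simp add: inverse_quat_def quat_eq_iff)
qed

end

instantiation quat :: real_inner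
begin

definition inner_quat :: "quat \<Rightarrow> quat \<Rightarrow> real" where
  "inner x y = Re0 x * Re0 y + Im1 x * Im1 y + Im2 x * Im2 y + Im3 x * Im3 y"

definition "norm x = sqrt (inner x x)" for x :: quat

definition "sgn x = x /\<^sub>R norm x" for x :: quat

definition "dist x y = norm (x - y)" for x y :: quat

definition uniformity_quat_def:
  "(uniformity :: (quat \<times> quat) filter) = (INF e\<in>{0 <..}. principal {(x, y). dist x y < e})"

definition open_quat_def:
  "open U \<longleftrightarrow> (\<forall>x\<in>U. eventually (\<lambda>(x', y). x' = x \<longrightarrow> y \<in> U) uniformity)"
  for U :: "quat set"

instance
proof
  fix x y z :: quat and r :: real and U :: "quat set"
  show "dist x y = norm (x - y)" by (fact dist_quat_def)
  show "sgn x = x /\<^sub>R norm x" by (fact sgn_quat_def)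
  show "uniformity = (INF e\<in>{0 <..}. principal {(x :: quat, y). dist x y < e})"
    by (fact uniformity_quat_def)
  show "open U \<longleftrightarrow> (\<forall>x\<in>U. eventually (\<lambda>(x', y). x' = x \<longrightarrow> y \<in> U) uniformity)"
    by (fact open_quat_def)
  show "norm x = sqrt (inner x x)" by (fact norm_quat_def)
  show "inner x y = inner y x" by (simp add: inner_quat_def mult.commute)
  show "inner (x + y) z = inner x z + inner y z"
    by (simp add: inner_quat_def algebra_simps)
  show "inner (r *\<^sub>R x) y = r * inner x y"
    by (simp add: inner_quat_def algebra_simps)
  show "0 \<le> inner x x" by (simp add: inner_quat_def)
  show "inner x x = 0 \<longleftrightarrow> x = 0"
    using quat_norm2_pos[of x]
    by (cases "x = 0") (simp_all add: inner_quat_def flip: power2_eq_square)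
qed

end

instance quat :: real_normed_div_algebra
proof
  fix x y :: quat
  have eq: "inner (x * y) (x * y) = inner x x * inner y y"
    by (simp only: inner_quat_def times_quat.sel) algebra
  show "norm (x * y) = norm x * norm y"
    by (simp only: norm_quat_def eq real_sqrt_mult)
qed

definition quat_i :: quat where "quat_i = Quat 0 1 0 0"
definition quat_j :: quat where "quat_j = Quat 0 0 1 0"
definition quat_k :: quat where "quat_k = Quat 0 0 0 1"

lemma quat_unit_sel [simp]:
  "Re0 quat_i = 0" "Im1 quat_i = 1" "Im2 quat_i = 0" "Im3 quat_i = 0"
  "Re0 quat_j = 0" "Im1 quat_j = 0" "Im2 quat_j = 1" "Im3 quat_j = 0"
  "Re0 quat_k = 0" "Im1 quat_k = 0" "Im2 quat_k = 0" "Im3 quat_k = 1"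
  by (simp_all add: quat_i_def quat_j_def quat_k_def)

lemma quat_unit_mult:
  "quat_i * quat_i = -1" "quat_j * quat_j = -1" "quat_k * quat_k = -1"
  "quat_i * quat_j = quat_k" "quat_j * quat_k = quat_i" "quat_k * quat_i = quat_j"
  "quat_j * quat_i = - quat_k" "quat_k * quat_j = - quat_i" "quat_i * quat_k = - quat_j"
  by (simp_all add: quat_eq_iff)

instantiation quat :: euclidean_space
begin

definition Basis_quat :: "quat set" where
  "Basis = {1, quat_i, quat_j, quat_k}"

instance
proof
  fix x u v :: quat
  show "(Basis :: quat set) \<noteq> {}" "finite (Basis :: quat set)"
    by (simp_all add: Basis_quat_def)
  show "inner u v = (if u = v then 1 else 0)" if "u \<in> Basis" "v \<in> Basis"
    using that unfolding Basis_quat_def insert_iff empty_iff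
    by (elim disjE FalseE; simp add: inner_quat_def quat_eq_iff)
  show "(\<forall>u\<in>Basis. inner x u = 0) \<longleftrightarrow> x = 0"
    by (simp add: Basis_quat_def inner_quat_def quat_eq_iff[of x 0])
qed

end


section \<open>Slice regular functions\<close>

definition imag_units :: "quat set" where
  "imag_units = {q. q\<^sup>2 = -1}"

definition slice_plane :: "quat \<Rightarrow> quat set" where
  "slice_plane I = span {1, I}"

definition symmetric_slice_domain :: "quat set \<Rightarrow> bool" where
  "symmetric_slice_domain \<Omega> \<longleftrightarrow>
     open \<Omega> \<and> connected \<Omega> \<and> \<Omega> \<inter> \<real> \<noteq> {} \<and>
     (\<forall>\<alpha> \<beta>. \<forall>I\<in>imag_units. of_real \<alpha> + I * of_real \<beta> \<in> \<Omega> \<longrightarrow>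
        (\<forall>J\<in>imag_units. of_real \<alpha> + J * of_real \<beta> \<in> \<Omega>))"

text \<open>
  A function on \<open>\<Omega>\<close> is represented by a total function of which only the values on
  \<open>\<Omega>\<close> matter. Holomorphy of the restriction to the slice of \<open>J\<close> means real
  differentiability in \<open>(\<alpha>, \<beta>)\<close> with differential \<open>D\<close> annihilated by the
  Cauchy--Riemann operator; \<open>D (1, 0)\<close> and \<open>D (0, 1)\<close> are the partial derivatives
  with respect to \<open>\<alpha>\<close> and \<open>\<beta>\<close>.
\<close>

definition slice_regular :: "quat set \<Rightarrow> (quat \<Rightarrow> quat) set" where
  "slice_regular \<Omega> =
     {f. \<forall>J\<in>imag_units. \<forall>\<alpha> \<beta>. of_real \<alpha> + J * of_real \<beta> \<in> \<Omega> \<longrightarrow>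
        (\<exists>D. ((\<lambda>(a, b). f (of_real a + J * of_real b)) has_derivative D) (at (\<alpha>, \<beta>)) \<and>
             (1/2) *\<^sub>R (D (1, 0) + J * D (0, 1)) = 0)}"

definition slice_preserving :: "quat set \<Rightarrow> (quat \<Rightarrow> quat) set" where
  "slice_preserving \<Omega> =
     {f \<in> slice_regular \<Omega>. \<forall>I\<in>imag_units. f ` (\<Omega> \<inter> slice_plane I) \<subseteq> slice_plane I}"

definition slice_preserving_at :: "quat set \<Rightarrow> quat \<Rightarrow> (quat \<Rightarrow> quat) set" where
  "slice_preserving_at \<Omega> J =
     {f \<in> slice_regular \<Omega>. f ` (\<Omega> \<inter> slice_plane J) \<subseteq> slice_plane J}"

text \<open>
  On a symmetric slice domain every slice regular \<open>f\<close> has such components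
  \<open>F 0, \<dots>, F 3\<close>, and their values on \<open>\<Omega>\<close> are uniquely determined, so that
  the choice below is immaterial on \<open>\<Omega>\<close>.
\<close>

definition is_slice_components ::
    "quat set \<Rightarrow> (quat \<Rightarrow> quat) \<Rightarrow> (nat \<Rightarrow> quat \<Rightarrow> quat) \<Rightarrow> bool" where
  "is_slice_components \<Omega> f F \<longleftrightarrow>
     (\<forall>n\<le>3. F n \<in> slice_preserving \<Omega>) \<and>
     (\<forall>q\<in>\<Omega>. f q = F 0 q + F 1 q * quat_i + F 2 q * quat_j + F 3 q * quat_k)"

definition slice_component :: "quat set \<Rightarrow> (quat \<Rightarrow> quat) \<Rightarrow> nat \<Rightarrow> quat \<Rightarrow> quat" where
  "slice_component \<Omega> f = (SOME F. is_slice_components \<Omega> f F)"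

definition regular_conj :: "quat set \<Rightarrow> (quat \<Rightarrow> quat) \<Rightarrow> quat \<Rightarrow> quat" where
  "regular_conj \<Omega> f = (let F = slice_component \<Omega> f in
     (\<lambda>q. F 0 q - F 1 q * quat_i - F 2 q * quat_j - F 3 q * quat_k))"

definition star_prod ::
    "quat set \<Rightarrow> (quat \<Rightarrow> quat) \<Rightarrow> (quat \<Rightarrow> quat) \<Rightarrow> quat \<Rightarrow> quat" where
  "star_prod \<Omega> f g = (let F = slice_component \<Omega> f; G = slice_component \<Omega> g in
     (\<lambda>q. F 0 q * G 0 q - F 1 q * G 1 q - F 2 q * G 2 q - F 3 q * G 3 q
        + F 0 q * (G 1 q * quat_i + G 2 q * quat_j + G 3 q * quat_k)
        + G 0 q * (F 1 q * quat_i + F 2 q * quat_j + F 3 q * quat_k)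
        + (F 2 q * G 3 q - F 3 q * G 2 q) * quat_i
        + (F 3 q * G 1 q - F 1 q * G 3 q) * quat_j
        + (F 1 q * G 2 q - F 2 q * G 1 q) * quat_k))"

definition star_inner ::
    "quat set \<Rightarrow> (quat \<Rightarrow> quat) \<Rightarrow> (quat \<Rightarrow> quat) \<Rightarrow> quat \<Rightarrow> quat" where
  "star_inner \<Omega> f g = slice_component \<Omega> (star_prod \<Omega> f (regular_conj \<Omega> g)) 0"

end

theory Submission
  imports Defs "HOL-Complex_Analysis.Conformal_Mappings"
begin

text \<open>
  Through the representation formula a slice regular function corresponds to a unique quadruple of
  conjugation-symmetric holomorphic functions on the planar shadow of \<open>\<Omega>\<close>, i.e. to a holomorphic
  function with values in the complexified quaternions; the \<open>*\<close>-product and the regular conjugate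
  become the pointwise product and conjugate there. Writing \<open>h\<close> for the stem of \<open>f * g\<close>, the inner
  products in (ii) and (iii) are, by cyclicity of the scalar part, \<open>\<plusminus>\<close> the complex-bilinear product of
  \<open>h\<close> with \<open>M\<^sub>0\<close>, and the vanishing of all of them says that the real and the imaginary part of \<open>h\<close>
  lie in the slice plane of \<open>I\<^sub>0\<close>, which is (i).
\<close>

section \<open>Imaginary units and slices\<close>

text \<open>The imaginary components of \<open>q * q\<close> are twice \<open>Re0 q\<close> times
  those of \<open>q\<close>, so a nonzero \<open>Re0 q\<close> would make \<open>q\<close> real with
  square -1.\<close>

lemma imag_units_iff:
  "q \<in> imag_units \<longleftrightarrow> Re0 q = 0 \<and> (Im1 q)\<^sup>2 + (Im2 q)\<^sup>2 + (Im3 q)\<^sup>2 = 1"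
proof
  assume "q \<in> imag_units"
  then have eqs: "Re0 q * Re0 q - Im1 q * Im1 q - Im2 q * Im2 q - Im3 q * Im3 q = -1"
    "Re0 q * Im1 q = 0" "Re0 q * Im2 q = 0" "Re0 q * Im3 q = 0"
    by (auto simp: imag_units_def power2_eq_square quat_eq_iff)
  have "Re0 q = 0"
  proof (rule ccontr)
    assume "Re0 q \<noteq> 0"
    with eqs have "Re0 q * Re0 q = -1" by simp
    then show False by (smt (verit) zero_le_square)
  qed
  with eqs show "Re0 q = 0 \<and> (Im1 q)\<^sup>2 + (Im2 q)\<^sup>2 + (Im3 q)\<^sup>2 = 1"
    by (simp add: power2_eq_square)
qed (simp add: imag_units_def quat_eq_iff power2_eq_square)

lemma quat_unit_imag_units [simp]: "quat_i \<in> imag_units" "quat_j \<in> imag_units" "quat_k \<in> imag_units"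
  by (simp_all add: imag_units_iff)

lemma imag_units_uminus: "I \<in> imag_units \<Longrightarrow> - I \<in> imag_units"
  by (simp add: imag_units_iff)

lemma imag_units_square: "I \<in> imag_units \<Longrightarrow> I * I = -1"
  by (simp add: imag_units_def power2_eq_square)

lemma imag_units_square_left: "I \<in> imag_units \<Longrightarrow> I * (I * x) = - x"
  by (simp add: imag_units_square flip: mult.assoc)

lemma norm_imag_units: "I \<in> imag_units \<Longrightarrow> norm I = 1"
  by (simp add: imag_units_iff norm_quat_def inner_quat_def power2_eq_square)

lemma quat_of_real_sel [simp]:
  "Re0 (of_real r) = r" "Im1 (of_real r) = 0" "Im2 (of_real r) = 0" "Im3 (of_real r) = 0"
  by (simp_all add: of_real_def)

definition slice_embed :: "quat \<Rightarrow> complex \<Rightarrow> quat" where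
  "slice_embed I z = of_real (Re z) + I * of_real (Im z)"

lemma slice_embed_sel [simp]:
  assumes "I \<in> imag_units"
  shows "Re0 (slice_embed I z) = Re z"
    and "Im1 (slice_embed I z) = Im1 I * Im z"
    and "Im2 (slice_embed I z) = Im2 I * Im z"
    and "Im3 (slice_embed I z) = Im3 I * Im z"
  using assms by (simp_all add: slice_embed_def imag_units_iff)

lemma slice_embed_scaleR: "slice_embed I z = Re z *\<^sub>R 1 + Im z *\<^sub>R I"
  by (simp add: slice_embed_def quat_eq_iff)

lemma slice_embed_simps [simp]:
  "slice_embed I 0 = 0" "slice_embed I 1 = 1" "slice_embed I \<i> = I"
  "slice_embed I (of_real r) = of_real r"
  by (simp_all add: slice_embed_def)

lemma slice_embed_linear:
  "slice_embed I (x + y) = slice_embed I x + slice_embed I y"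
  "slice_embed I (x - y) = slice_embed I x - slice_embed I y"
  "slice_embed I (- x) = - slice_embed I x"
  by (simp_all add: slice_embed_def algebra_simps)

lemma slice_embed_mult:
  assumes "I \<in> imag_units"
  shows "slice_embed I (x * y) = slice_embed I x * slice_embed I y"
proof -
  have sq: "Im1 I * Im1 I + Im2 I * Im2 I + Im3 I * Im3 I = 1"
    using assms by (simp add: imag_units_iff power2_eq_square)
  have "Im x * Im y * (Im1 I * Im1 I + Im2 I * Im2 I + Im3 I * Im3 I) = Im x * Im y"
    by (simp only: sq mult_1_right)
  then show ?thesis
    using assms by (simp add: quat_eq_iff algebra_simps)
qed

text \<open>The units \<open>I\<close> and \<open>- I\<close> span the same slice with opposite
  orientation; this is the source of every conjugation symmetry below.\<close>

lemma slice_embed_uminus_cnj: "slice_embed (- I) (cnj z) = slice_embed I z"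
  by (simp add: slice_embed_def)

lemma bounded_linear_slice_embed: "bounded_linear (slice_embed I)"
  unfolding slice_embed_scaleR
  by (intro bounded_linear_add bounded_linear_scaleR_const bounded_linear_Re bounded_linear_Im)

lemma slice_plane_eq_range: "slice_plane I = range (slice_embed I)"
proof
  show "slice_plane I \<subseteq> range (slice_embed I)"
  proof
    fix q assume "q \<in> slice_plane I"
    then obtain a b where "q - a *\<^sub>R 1 = b *\<^sub>R I"
      by (auto simp: slice_plane_def span_insert span_singleton)
    then have "q = slice_embed I (Complex a b)"
      by (simp add: slice_embed_scaleR algebra_simps)
    then show "q \<in> range (slice_embed I)" by blast
  qed
  show "range (slice_embed I) \<subseteq> slice_plane I"
    unfolding slice_plane_def slice_embed_scaleR image_subset_iff
    by (intro ballI span_add span_scale span_base) simp_all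
qed

text \<open>The representative of the sphere through \<open>q\<close> in the closed upper half
  plane.\<close>

definition shadow_point :: "quat \<Rightarrow> complex" where
  "shadow_point q = Complex (Re0 q) (norm (q - of_real (Re0 q)))"

text \<open>For real \<open>q\<close> the direction is \<open>0\<close>, not an imaginary unit.\<close>

definition direction :: "quat \<Rightarrow> quat" where
  "direction q = sgn (q - of_real (Re0 q))"

lemma slice_embed_minus_real: "slice_embed I z - of_real (Re z) = Im z *\<^sub>R I"
  by (simp add: slice_embed_scaleR of_real_def)

lemma shadow_point_slice_embed:
  assumes "I \<in> imag_units"
  shows "shadow_point (slice_embed I z) = Complex (Re z) \<bar>Im z\<bar>"
  using assms by (simp add: shadow_point_def slice_embed_minus_real norm_imag_units)

lemma direction_slice_embed:
  assumes "I \<in> imag_units"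
  shows "direction (slice_embed I z) = sgn (Im z) *\<^sub>R I"
  using assms by (simp add: direction_def slice_embed_minus_real sgn_scaleR)
    (simp add: sgn_div_norm norm_imag_units)

lemma direction_imag_units:
  assumes "Im (shadow_point q) \<noteq> 0"
  shows "direction q \<in> imag_units"
proof -
  let ?p = "q - of_real (Re0 q)"
  have nz: "?p \<noteq> 0" using assms by (auto simp: shadow_point_def)
  then have "norm (direction q) = 1" by (simp add: direction_def norm_sgn)
  moreover have "Re0 (direction q) = 0"
    by (simp add: direction_def sgn_div_norm)
  ultimately show ?thesis
    by (simp add: imag_units_iff norm_quat_def inner_quat_def power2_eq_square)
qed

lemma slice_embed_shadow_point:
  obtains I where "I \<in> imag_units" "q = slice_embed I (shadow_point q)"
proof (cases "Im (shadow_point q) = 0")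
  case True
  \<comment> \<open>A real point lies in every slice, so any unit will do.\<close>
  then have "q = of_real (Re0 q)" by (simp add: shadow_point_def)
  then have "q = slice_embed quat_i (shadow_point q)"
    using True by (simp add: slice_embed_def) (simp add: shadow_point_def)
  then show ?thesis using that[of quat_i] by simp
next
  case False
  then have "q = slice_embed (direction q) (shadow_point q)"
    by (simp add: slice_embed_scaleR direction_def sgn_div_norm shadow_point_def of_real_def)
  then show ?thesis using that direction_imag_units[OF False] by blast
qed

lemma continuous_on_shadow_point: "continuous_on S shadow_point"
proof -
  have eq: "shadow_point = (\<lambda>q. of_real (inner 1 q) + \<i> * of_real (norm (q - of_real (inner 1 q))))"
    by (auto simp: fun_eq_iff shadow_point_def inner_quat_def complex_eq_iff)
  show ?thesis unfolding eq by (intro continuous_intros)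
qed

section \<open>The planar shadow of a symmetric slice domain\<close>

definition slice_shadow :: "quat set \<Rightarrow> complex set" where
  "slice_shadow \<Omega> = {z. slice_embed quat_i z \<in> \<Omega>}"

context
  fixes \<Omega> :: "quat set"
  assumes \<Omega>: "symmetric_slice_domain \<Omega>"
begin

text \<open>Axial symmetry makes the choice of \<open>quat_i\<close> in \<open>slice_shadow\<close>
  immaterial.\<close>

lemma slice_embed_mem_iff: "I \<in> imag_units \<Longrightarrow> slice_embed I z \<in> \<Omega> \<longleftrightarrow> z \<in> slice_shadow \<Omega>"
  using \<Omega> quat_unit_imag_units(1)
  unfolding symmetric_slice_domain_def slice_shadow_def slice_embed_def mem_Collect_eq by blast

lemma slice_shadow_cnj: "cnj z \<in> slice_shadow \<Omega> \<longleftrightarrow> z \<in> slice_shadow \<Omega>"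
  using slice_embed_mem_iff[of "- quat_i" "cnj z"] slice_embed_mem_iff[of quat_i z]
  by (simp add: slice_embed_uminus_cnj imag_units_uminus)

lemma slice_shadow_obtain:
  assumes "q \<in> \<Omega>"
  obtains I z where "I \<in> imag_units" "z \<in> slice_shadow \<Omega>" "q = slice_embed I z"
  using slice_embed_shadow_point[of q] assms slice_embed_mem_iff by metis

lemma slice_plane_obtain:
  assumes "q \<in> \<Omega>" "q \<in> slice_plane I" "I \<in> imag_units"
  obtains z where "z \<in> slice_shadow \<Omega>" "q = slice_embed I z"
  using assms slice_embed_mem_iff by (auto simp: slice_plane_eq_range)

lemma open_slice_shadow: "open (slice_shadow \<Omega>)"
proof -
  have "continuous_on UNIV (slice_embed quat_i)"
    by (simp add: bounded_linear_slice_embed linear_continuous_on)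
  then have "open (slice_embed quat_i -` \<Omega>)"
    using \<Omega> by (simp add: symmetric_slice_domain_def open_vimage)
  then show ?thesis by (simp add: slice_shadow_def vimage_def)
qed

lemma slice_shadow_real: obtains x :: real where "of_real x \<in> slice_shadow \<Omega>"
  using \<Omega> that by (auto simp: symmetric_slice_domain_def slice_shadow_def elim!: Reals_cases)

text \<open>The closed upper half of the shadow is the continuous image of \<Omega> under
  \<open>shadow_point\<close>, hence connected. Together with its mirror image it covers the shadow,
  and the two halves meet at a real point of \<Omega>.\<close>

lemma connected_slice_shadow: "connected (slice_shadow \<Omega>)"
proof -
  let ?U = "shadow_point ` \<Omega>"
  have "connected ?U"
    using \<Omega> by (intro connected_continuous_image continuous_on_shadow_point)
      (simp add: symmetric_slice_domain_def)
  moreover have "connected (cnj ` ?U)"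
    by (intro connected_continuous_image calculation continuous_intros)
  moreover obtain x where x: "of_real x \<in> slice_shadow \<Omega>" by (rule slice_shadow_real)
  then have "complex_of_real x = shadow_point (of_real x)" "of_real x \<in> \<Omega>"
    by (auto simp: shadow_point_def slice_shadow_def complex_eq_iff)
  then have "complex_of_real x \<in> ?U \<inter> cnj ` ?U"
    by (metis Int_iff complex_cnj_complex_of_real imageI)
  ultimately have "connected (?U \<union> cnj ` ?U)"
    by (intro connected_Un) auto
  moreover have "?U \<union> cnj ` ?U = slice_shadow \<Omega>"
  proof
    have "?U \<subseteq> slice_shadow \<Omega>"
    proof
      fix z assume "z \<in> ?U"
      then obtain q where "q \<in> \<Omega>" "z = shadow_point q" by blast
      then show "z \<in> slice_shadow \<Omega>"
        using slice_embed_shadow_point[of q] slice_embed_mem_iff by metis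
    qed
    then show "?U \<union> cnj ` ?U \<subseteq> slice_shadow \<Omega>"
      using slice_shadow_cnj by blast
    show "slice_shadow \<Omega> \<subseteq> ?U \<union> cnj ` ?U"
    proof
      fix z assume "z \<in> slice_shadow \<Omega>"
      then have "Complex (Re z) \<bar>Im z\<bar> \<in> ?U"
        using shadow_point_slice_embed[of quat_i z]
        by (metis quat_unit_imag_units(1) imageI slice_embed_mem_iff)
      moreover have "z = Complex (Re z) \<bar>Im z\<bar> \<or> z = cnj (Complex (Re z) \<bar>Im z\<bar>)"
        by (auto simp: complex_eq_iff)
      ultimately show "z \<in> ?U \<union> cnj ` ?U" by (metis UnI1 UnI2 imageI)
    qed
  qed
  ultimately show ?thesis by simp
qed

end

section \<open>The identity principle and the representation formula\<close>

text \<open>\<open>d' \<i> = I * d' 1\<close> is the Cauchy--Riemann equation multiplied by \<open>I\<close> from the left.\<close>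

definition slice_holomorphic_on :: "quat \<Rightarrow> (complex \<Rightarrow> quat) \<Rightarrow> complex set \<Rightarrow> bool" where
  "slice_holomorphic_on I d S \<longleftrightarrow>
     (\<forall>z\<in>S. \<exists>d'. (d has_derivative d') (at z) \<and> d' \<i> = I * d' 1)"

text \<open>A real-linear map of the plane that commutes with \<i> at 1 is multiplication by its
  value at 1.\<close>

lemma has_field_derivative_Cauchy_Riemann:
  assumes "(f has_derivative f') (at z)" and "f' \<i> = \<i> * f' 1"
  shows "(f has_field_derivative f' 1) (at z)"
proof -
  interpret f': bounded_linear f' by (rule has_derivative_bounded_linear[OF assms(1)])
  have "f' h = f' 1 * h" for h
  proof -
    have "f' h = f' (Re h *\<^sub>R 1 + Im h *\<^sub>R \<i>)"
      by (rule arg_cong[where f = f']) (simp add: complex_eq_iff)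
    also have "\<dots> = f' 1 * h"
      using assms(2) by (simp only: f'.add f'.scaleR) (simp add: complex_eq_iff algebra_simps)
    finally show ?thesis .
  qed
  then have "f' = (*) (f' 1)" by blast
  then show ?thesis using assms(1) by (simp add: has_field_derivative_def)
qed

text \<open>For every \<open>c\<close> the complex function \<open>\<langle>c, d\<rangle> - \<i> \<langle>c, I d\<rangle>\<close> is holomorphic, so the
  complex identity theorem applies without splitting \<open>d\<close> along an orthogonal unit.\<close>

lemma slice_holomorphic_zero:
  assumes S: "open S" "connected S" and I: "I \<in> imag_units"
    and d: "slice_holomorphic_on I d S"
    and x: "complex_of_real x \<in> S"
    and zero: "\<And>r. complex_of_real r \<in> S \<Longrightarrow> d (of_real r) = 0"
    and z: "z \<in> S"
  shows "d z = 0"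
proof -
  have "inner c (d z) = 0" for c
  proof -
    define \<phi> where "\<phi> z = of_real (inner c (d z)) - \<i> * of_real (inner c (I * d z))" for z
    have "\<phi> holomorphic_on S"
    proof (rule holomorphic_onI)
      fix z assume "z \<in> S"
      then obtain d' where d': "(d has_derivative d') (at z)" "d' \<i> = I * d' 1"
        using d by (auto simp: slice_holomorphic_on_def)
      define \<phi>' where "\<phi>' h = of_real (inner c (d' h)) - \<i> * of_real (inner c (I * d' h))" for h
      have "(\<phi> has_derivative \<phi>') (at z)"
        unfolding \<phi>_def \<phi>'_def using d'(1) by (auto intro!: derivative_eq_intros)
      moreover have "\<phi>' \<i> = \<i> * \<phi>' 1"
        using d'(2) imag_units_square_left[OF I] by (simp add: \<phi>'_def complex_eq_iff)
      ultimately show "\<phi> field_differentiable at z within S"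
        using has_field_derivative_Cauchy_Riemann field_differentiable_at_within
          field_differentiable_def by blast
    qed
    \<comment> \<open>Analytic continuation needs zeros accumulating at a point of \<open>S\<close>;
      real points near \<open>x\<close> serve, and the minimum with \<open>r\<close> keeps them
      inside \<open>S\<close>.\<close>
    moreover have "\<exists>y\<in>S \<inter> \<real>. y \<noteq> of_real x \<and> dist y (of_real x) < e" if "e > 0" for e
    proof -
      obtain r where r: "r > 0" "ball (complex_of_real x) r \<subseteq> S"
        using S(1) x open_contains_ball by blast
      let ?y = "complex_of_real (x + min e r / 2)"
      have "dist (complex_of_real x) ?y = min e r / 2"
        using r \<open>e > 0\<close> by (simp add: dist_norm)
      moreover have "?y \<noteq> of_real x" using r \<open>e > 0\<close> by (auto simp flip: of_real_add)
      ultimately show ?thesis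
        using r \<open>e > 0\<close> by (intro bexI[of _ ?y]) (auto simp: dist_commute subset_iff)
    qed
    then have "complex_of_real x islimpt (S \<inter> \<real>)"
      by (simp add: islimpt_approachable)
    moreover have "\<phi> y = 0" if "y \<in> S \<inter> \<real>" for y
      using that zero by (auto simp: \<phi>_def elim!: Reals_cases)
    ultimately have "\<phi> z = 0"
      using analytic_continuation[OF _ S Int_lower1 x] z by blast
    then show ?thesis by (simp add: \<phi>_def complex_eq_iff)
  qed
  then show ?thesis using inner_eq_zero_iff by blast
qed

text \<open>Composition with the linear identification of real pairs and complex numbers, in both
  directions, transports the differential; left multiplication by \<open>I\<close> solves the
  Cauchy--Riemann equation for the \<beta>-derivative.\<close>

lemma slice_regular_iff:
  "f \<in> slice_regular \<Omega> \<longleftrightarrow>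
     (\<forall>I\<in>imag_units. slice_holomorphic_on I (\<lambda>z. f (slice_embed I z)) {z. slice_embed I z \<in> \<Omega>})"
  (is "?L \<longleftrightarrow> ?R")
proof -
  have CR: "(1/2) *\<^sub>R (a + I * b) = 0 \<longleftrightarrow> b = I * a" if "I \<in> imag_units" for I a b :: quat
  proof
    assume "(1/2) *\<^sub>R (a + I * b) = 0"
    then have "I * (a + I * b) = 0" by simp
    then show "b = I * a"
      using that by (simp add: distrib_left imag_units_square_left)
  next
    assume "b = I * a"
    then show "(1/2) *\<^sub>R (a + I * b) = 0"
      using that by (simp add: imag_units_square_left)
  qed
  have coord: "((\<lambda>z. (Re z, Im z)) has_derivative (\<lambda>z. (Re z, Im z))) (at z within S)" for z S
    by (rule has_derivative_Pair)
      (simp_all add: bounded_linear_imp_has_derivative bounded_linear_Re bounded_linear_Im)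
  have cplx: "((\<lambda>(a, b). Complex a b) has_derivative (\<lambda>(a, b). Complex a b)) F" for F
    unfolding case_prod_unfold Complex_eq by (auto intro!: derivative_eq_intros)
  show ?thesis
  proof
    assume ?L
    show ?R
      unfolding slice_holomorphic_on_def
    proof (intro ballI)
      fix I z assume I: "I \<in> imag_units" and "z \<in> {z. slice_embed I z \<in> \<Omega>}"
      then obtain D where D: "((\<lambda>(a, b). f (of_real a + I * of_real b)) has_derivative D) (at (Re z, Im z))"
        "(1/2) *\<^sub>R (D (1, 0) + I * D (0, 1)) = 0"
        using \<open>?L\<close> by (fastforce simp: slice_regular_def slice_embed_def)
      have "((\<lambda>z. f (slice_embed I z)) has_derivative (\<lambda>z. D (Re z, Im z))) (at z)"
        using has_derivative_compose[OF coord, of "\<lambda>(a, b). f (of_real a + I * of_real b)" D z UNIV] D(1)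
        by (simp add: slice_embed_def)
      with CR[OF I, THEN iffD1, OF D(2)] show "\<exists>d'. ((\<lambda>z. f (slice_embed I z)) has_derivative d') (at z) \<and> d' \<i> = I * d' 1"
        by (intro exI[of _ "\<lambda>z. D (Re z, Im z)"]) simp
    qed
  next
    assume ?R
    show ?L
      unfolding slice_regular_def mem_Collect_eq
    proof (intro ballI allI impI)
      fix I \<alpha> \<beta> assume I: "I \<in> imag_units" and "of_real \<alpha> + I * of_real \<beta> \<in> \<Omega>"
      then have "Complex \<alpha> \<beta> \<in> {z. slice_embed I z \<in> \<Omega>}" by (simp add: slice_embed_def)
      then obtain D where D: "((\<lambda>z. f (slice_embed I z)) has_derivative D) (at (Complex \<alpha> \<beta>))"
        "D \<i> = I * D 1"
        using \<open>?R\<close> I unfolding slice_holomorphic_on_def by blast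
      have "((\<lambda>(a, b). f (of_real a + I * of_real b)) has_derivative (\<lambda>(a, b). D (Complex a b))) (at (\<alpha>, \<beta>))"
        using has_derivative_compose[OF cplx, of "\<lambda>z. f (slice_embed I z)" D "(\<alpha>, \<beta>)" UNIV] D(1)
        by (simp add: slice_embed_def case_prod_unfold)
      with CR[OF I, THEN iffD2, OF D(2)] show "\<exists>D. ((\<lambda>(a, b). f (of_real a + I * of_real b)) has_derivative D) (at (\<alpha>, \<beta>)) \<and>
          (1/2) *\<^sub>R (D (1, 0) + I * D (0, 1)) = 0"
        by (intro exI[of _ "\<lambda>(a, b). D (Complex a b)"]) (simp add: Complex_eq)
    qed
  qed
qed

section \<open>Stem functions\<close>

text \<open>The value at a point of the slice of \<open>I\<close> determined by four complex numbers, identified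
  with an element of the complexified quaternions.\<close>

definition slice_comb :: "quat \<Rightarrow> (nat \<Rightarrow> complex) \<Rightarrow> quat" where
  "slice_comb I c = slice_embed I (c 0) + slice_embed I (c 1) * quat_i
     + slice_embed I (c 2) * quat_j + slice_embed I (c 3) * quat_k"

text \<open>\<open>I\<close> always stands to the left of the basis units, so the real parts of the
  entries assemble into one quaternion and the imaginary parts into another.\<close>

lemma slice_comb_split:
  "slice_comb I c = Quat (Re (c 0)) (Re (c 1)) (Re (c 2)) (Re (c 3))
     + I * Quat (Im (c 0)) (Im (c 1)) (Im (c 2)) (Im (c 3))"
  by (simp add: slice_comb_def slice_embed_def quat_eq_iff)

text \<open>This turns complex linearity of the derivative of a stem into the Cauchy--Riemann
  equation on the slice of \<open>I\<close>.\<close>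

lemma slice_comb_mult_imag:
  assumes "I \<in> imag_units"
  shows "slice_comb I (\<lambda>n. c n * \<i>) = I * slice_comb I c"
  unfolding slice_comb_def mult.commute[of _ \<i>]
  using assms by (simp add: slice_embed_mult algebra_simps)

text \<open>One unit gives only the sum a + I b of the two quaternions in
  \<open>slice_comb_split\<close>; the opposite unit gives a - I b, and the two together determine a
  and b.\<close>

lemma slice_comb_inject:
  assumes "slice_comb quat_i c = slice_comb quat_i c'"
    and "slice_comb (- quat_i) c = slice_comb (- quat_i) c'"
    and "n \<le> 3"
  shows "c n = c' n"
proof -
  have "n = 0 \<or> n = 1 \<or> n = 2 \<or> n = 3" using assms(3) by linarith
  with assms(1,2) show ?thesis
    unfolding slice_comb_split by (auto simp: quat_eq_iff complex_eq_iff)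
qed

text \<open>The same point is reached from \<open>z\<close> with \<open>I\<close> and from
  \<open>cnj z\<close> with \<open>- I\<close>; the conjugation symmetry makes both give the same
  value.\<close>

definition intrinsic_on :: "complex set \<Rightarrow> (complex \<Rightarrow> complex) \<Rightarrow> bool" where
  "intrinsic_on S w \<longleftrightarrow> w holomorphic_on S \<and> (\<forall>z\<in>S. w (cnj z) = cnj (w z))"

lemma intrinsic_on_intros:
  assumes "intrinsic_on S u" "intrinsic_on S v"
  shows "intrinsic_on S (\<lambda>z. u z + v z)" "intrinsic_on S (\<lambda>z. u z - v z)"
    "intrinsic_on S (\<lambda>z. u z * v z)"
  using assms by (auto simp: intrinsic_on_def intro: holomorphic_intros)

lemma intrinsic_on_uminus: "intrinsic_on S u \<Longrightarrow> intrinsic_on S (\<lambda>z. - u z)"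
  by (auto simp: intrinsic_on_def intro: holomorphic_intros)

lemma intrinsic_on_if:
  "(b \<Longrightarrow> intrinsic_on S u) \<Longrightarrow> (\<not> b \<Longrightarrow> intrinsic_on S v) \<Longrightarrow>
    intrinsic_on S (\<lambda>z. if b then u z else v z)"
  by (cases b) simp_all

lemma intrinsic_on_of_real: "intrinsic_on S (\<lambda>z. of_real r)"
  by (simp add: intrinsic_on_def)

definition is_stem :: "quat set \<Rightarrow> (quat \<Rightarrow> quat) \<Rightarrow> (nat \<Rightarrow> complex \<Rightarrow> complex) \<Rightarrow> bool" where
  "is_stem \<Omega> f w \<longleftrightarrow> (\<forall>n\<le>3. intrinsic_on (slice_shadow \<Omega>) (w n)) \<and>
     (\<forall>I\<in>imag_units. \<forall>z\<in>slice_shadow \<Omega>. f (slice_embed I z) = slice_comb I (\<lambda>n. w n z))"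

lemma is_stemD:
  assumes "is_stem \<Omega> f w"
  shows "n \<le> 3 \<Longrightarrow> intrinsic_on (slice_shadow \<Omega>) (w n)"
    and "I \<in> imag_units \<Longrightarrow> z \<in> slice_shadow \<Omega> \<Longrightarrow> f (slice_embed I z) = slice_comb I (\<lambda>n. w n z)"
  using assms by (auto simp: is_stem_def)

lemma is_stem_unique:
  assumes "is_stem \<Omega> f w" "is_stem \<Omega> f w'" "n \<le> 3" "z \<in> slice_shadow \<Omega>"
  shows "w n z = w' n z"
  using slice_comb_inject[of "\<lambda>n. w n z" "\<lambda>n. w' n z" n] assms
  by (simp add: is_stem_def imag_units_uminus)

text \<open>The function on quaternions induced by a single complex stem entry. At a real point the
  direction is 0, so only the real part of \<open>w\<close> enters there.\<close>

definition slice_lift :: "(complex \<Rightarrow> complex) \<Rightarrow> quat \<Rightarrow> quat" where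
  "slice_lift w q = slice_embed (direction q) (w (shadow_point q))"

definition quat_basis :: "nat \<Rightarrow> quat" where
  "quat_basis n = (if n = 0 then 1 else if n = 1 then quat_i else if n = 2 then quat_j else quat_k)"

lemma slice_comb_quat_basis:
  "slice_comb I (\<lambda>n. of_real (inner (quat_basis n) a) + \<i> * of_real (inner (quat_basis n) b)) = a + I * b"
  by (simp add: slice_comb_split quat_eq_iff quat_basis_def inner_quat_def)

context
  fixes \<Omega> :: "quat set"
  assumes \<Omega>: "symmetric_slice_domain \<Omega>"
begin

lemma slice_lift_slice_embed:
  assumes w: "intrinsic_on (slice_shadow \<Omega>) w" and I: "I \<in> imag_units" and z: "z \<in> slice_shadow \<Omega>"
  shows "slice_lift w (slice_embed I z) = slice_embed I (w z)"
proof -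
  have cnj: "w (cnj z) = cnj (w z)" using w z by (simp add: intrinsic_on_def)
  consider "Im z = 0" | "Im z > 0" | "Im z < 0" by linarith
  then show ?thesis
  proof cases
    case 1
    then have "cnj z = z" "Complex (Re z) 0 = z" by (simp_all add: complex_eq_iff)
    \<comment> \<open>Conjugation symmetry makes \<open>w\<close> real at real points, so the
      vanishing direction loses nothing.\<close>
    moreover from this cnj have "w z = cnj (w z)" by simp
    then have "Im (w z) = 0" by (simp add: complex_eq_iff)
    ultimately show ?thesis
      using 1 I by (simp add: slice_lift_def direction_slice_embed shadow_point_slice_embed)
        (simp add: slice_embed_def)
  next
    case 2
    then have "Complex (Re z) \<bar>Im z\<bar> = z" by (simp add: complex_eq_iff)
    with 2 I show ?thesis
      by (simp add: slice_lift_def direction_slice_embed shadow_point_slice_embed)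
  next
    case 3
    then have "Complex (Re z) \<bar>Im z\<bar> = cnj z" by (simp add: complex_eq_iff)
    with 3 I cnj show ?thesis
      by (simp add: slice_lift_def direction_slice_embed shadow_point_slice_embed
          slice_embed_uminus_cnj)
  qed
qed

text \<open>The differential of each stem entry is a complex multiplication, so by
  \<open>slice_comb_mult_imag\<close> the differential on the slice of \<open>I\<close> takes \<i>
  to \<open>I\<close> times its value at 1.\<close>

lemma slice_regular_is_stem:
  assumes "is_stem \<Omega> f w"
  shows "f \<in> slice_regular \<Omega>"
  unfolding slice_regular_iff slice_holomorphic_on_def
proof (intro ballI)
  fix I z assume I: "I \<in> imag_units" and "z \<in> {z. slice_embed I z \<in> \<Omega>}"
  then have z: "z \<in> slice_shadow \<Omega>" using slice_embed_mem_iff[OF \<Omega> I] by simp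
  define w' where "w' n = deriv (w n) z" for n
  have w': "(w n has_derivative (\<lambda>h. w' n * h)) (at z)" if "n \<le> 3" for n
    using is_stemD(1)[OF assms that] z open_slice_shadow[OF \<Omega>]
    unfolding w'_def intrinsic_on_def
    by (metis DERIV_deriv_iff_field_differentiable has_field_derivative_def
        holomorphic_on_imp_differentiable_at)
  have "((\<lambda>z. slice_embed I (w n z)) has_derivative (\<lambda>h. slice_embed I (w' n * h))) (at z)"
    if "n \<le> 3" for n
    by (rule bounded_linear.has_derivative[OF bounded_linear_slice_embed w'[OF that]])
  from this[of 0] this[of 1] this[of 2] this[of 3]
  have D: "((\<lambda>z. slice_comb I (\<lambda>n. w n z)) has_derivative (\<lambda>h. slice_comb I (\<lambda>n. w' n * h))) (at z)"
    unfolding slice_comb_def by (auto intro!: derivative_eq_intros)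
  have "((\<lambda>z. f (slice_embed I z)) has_derivative (\<lambda>h. slice_comb I (\<lambda>n. w' n * h))) (at z)"
    by (rule has_derivative_transform_within_open[OF D open_slice_shadow[OF \<Omega>] z])
      (simp add: is_stemD(2)[OF assms I])
  then show "\<exists>d'. ((\<lambda>z. f (slice_embed I z)) has_derivative d') (at z) \<and> d' \<i> = I * d' 1"
    using slice_comb_mult_imag[OF I, of w'] by (intro exI conjI) auto
qed

text \<open>Representation formula: \<open>A\<close> and \<open>B\<close> are determined by the values of \<open>f\<close> on the slice of
  \<open>quat_i\<close>, and \<open>f (\<alpha> + I \<beta>) - (A + I B)\<close> vanishes on the real axis, hence everywhere.\<close>

lemma slice_regular_stem:
  assumes f: "f \<in> slice_regular \<Omega>"
  obtains w where "is_stem \<Omega> f w"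
proof -
  \<comment> \<open>Even and odd parts under conjugation, normalized so that
    \<open>A z + quat_i * B z\<close> is the value of \<open>f\<close> on the slice of
    \<open>quat_i\<close>. Their parity yields the conjugation symmetry of \<open>w\<close>.\<close>
  define A where "A z = (1/2) *\<^sub>R (f (slice_embed quat_i z) + f (slice_embed quat_i (cnj z)))" for z
  define B where
    "B z = - ((1/2) *\<^sub>R (quat_i * (f (slice_embed quat_i z) - f (slice_embed quat_i (cnj z)))))" for z
  define w where
    "w n z = of_real (inner (quat_basis n) (A z)) + \<i> * of_real (inner (quat_basis n) (B z))" for n z
  have hol: "slice_holomorphic_on I (\<lambda>z. f (slice_embed I z)) (slice_shadow \<Omega>)"
    if "I \<in> imag_units" for I
  proof -
    have "{z. slice_embed I z \<in> \<Omega>} = slice_shadow \<Omega>"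
      using slice_embed_mem_iff[OF \<Omega> that] by blast
    moreover have "slice_holomorphic_on I (\<lambda>z. f (slice_embed I z)) {z. slice_embed I z \<in> \<Omega>}"
      using f that unfolding slice_regular_iff by blast
    ultimately show ?thesis by simp
  qed
  \<comment> \<open>These are the Cauchy--Riemann equations of A + \<i> B with an imaginary unit
    \<i> commuting with all quaternions, hence of each coordinate \<open>w n\<close>.\<close>
  have CR: "\<exists>A' B'. (A has_derivative A') (at z) \<and> (B has_derivative B') (at z) \<and>
      A' \<i> = - B' 1 \<and> B' \<i> = A' 1" if z: "z \<in> slice_shadow \<Omega>" for z
  proof -
    obtain D where D: "((\<lambda>z. f (slice_embed quat_i z)) has_derivative D) (at z)" "D \<i> = quat_i * D 1"
      using hol[of quat_i] z by (auto simp: slice_holomorphic_on_def)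
    obtain E where E: "((\<lambda>z. f (slice_embed quat_i z)) has_derivative E) (at (cnj z))"
      "E \<i> = quat_i * E 1"
      using hol[of quat_i] z slice_shadow_cnj[OF \<Omega>] by (auto simp: slice_holomorphic_on_def)
    have "(cnj has_derivative cnj) (at z)"
      by (intro bounded_linear_imp_has_derivative bounded_linear_cnj)
    from has_derivative_compose[OF this E(1)]
    have E': "((\<lambda>z. f (slice_embed quat_i (cnj z))) has_derivative (\<lambda>h. E (cnj h))) (at z)" .
    have "E (- \<i>) = - E \<i>"
      using E(1) by (simp add: has_derivative_bounded_linear linear_simps)
    with E(2) have Ei: "E (- \<i>) = - (quat_i * E 1)" by simp
    define A' where "A' h = (1/2) *\<^sub>R (D h + E (cnj h))" for h
    define B' where "B' h = - ((1/2) *\<^sub>R (quat_i * (D h - E (cnj h))))" for h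
    have "(A has_derivative A') (at z)" "(B has_derivative B') (at z)"
      unfolding A_def B_def A'_def B'_def using D(1) E' by (auto intro!: derivative_eq_intros)
    moreover have "A' \<i> = - B' 1" "B' \<i> = A' 1"
      by (simp_all add: A'_def B'_def D(2) Ei quat_eq_iff field_simps)
    ultimately show ?thesis by blast
  qed
  have intr: "intrinsic_on (slice_shadow \<Omega>) (w n)" for n
    unfolding intrinsic_on_def
  proof (intro conjI ballI holomorphic_onI)
    fix z assume "z \<in> slice_shadow \<Omega>"
    from CR[OF this] obtain A' B' where AB: "(A has_derivative A') (at z)" "(B has_derivative B') (at z)"
      "A' \<i> = - B' 1" "B' \<i> = A' 1" by blast
    define w' where
      "w' h = of_real (inner (quat_basis n) (A' h)) + \<i> * of_real (inner (quat_basis n) (B' h))" for h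
    have "(w n has_derivative w') (at z)"
      unfolding w_def w'_def using AB(1,2) by (auto intro!: derivative_eq_intros)
    moreover have "w' \<i> = \<i> * w' 1"
      by (simp add: w'_def AB(3,4) complex_eq_iff)
    ultimately show "w n field_differentiable at z within slice_shadow \<Omega>"
      using has_field_derivative_Cauchy_Riemann field_differentiable_at_within
        field_differentiable_def by blast
  next
    fix z
    show "w n (cnj z) = cnj (w n z)"
      by (simp add: w_def A_def B_def inner_quat_def complex_eq_iff algebra_simps)
  qed
  have "f (slice_embed I z) = slice_comb I (\<lambda>n. w n z)"
    if I: "I \<in> imag_units" and z: "z \<in> slice_shadow \<Omega>" for I z
  proof -
    define d where "d z = f (slice_embed I z) - (A z + I * B z)" for z
    have "slice_holomorphic_on I d (slice_shadow \<Omega>)"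
      unfolding slice_holomorphic_on_def
    proof
      fix z assume "z \<in> slice_shadow \<Omega>"
      then obtain D A' B' where D: "((\<lambda>z. f (slice_embed I z)) has_derivative D) (at z)" "D \<i> = I * D 1"
        and AB: "(A has_derivative A') (at z)" "(B has_derivative B') (at z)"
          "A' \<i> = - B' 1" "B' \<i> = A' 1"
        using hol[OF I] CR unfolding slice_holomorphic_on_def by meson
      have "(d has_derivative (\<lambda>h. D h - (A' h + I * B' h))) (at z)"
        unfolding d_def using D(1) AB(1,2) by (auto intro!: derivative_eq_intros)
      moreover have "D \<i> - (A' \<i> + I * B' \<i>) = I * (D 1 - (A' 1 + I * B' 1))"
        by (simp add: D(2) AB(3,4) right_diff_distrib distrib_left imag_units_square_left[OF I])
      ultimately show "\<exists>d'. (d has_derivative d') (at z) \<and> d' \<i> = I * d' 1"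
        by blast
    qed
    moreover obtain x where "complex_of_real x \<in> slice_shadow \<Omega>" by (rule slice_shadow_real[OF \<Omega>])
    \<comment> \<open>On the real axis conjugation is trivial, so \<open>B\<close> vanishes and
      \<open>A\<close> equals \<open>f\<close>.\<close>
    moreover have "d (of_real r) = 0" for r
      by (simp add: d_def A_def B_def flip: scaleR_2)
    ultimately have "d z = 0"
      using slice_holomorphic_zero[OF open_slice_shadow[OF \<Omega>] connected_slice_shadow[OF \<Omega>] I _ _ _ z]
      by blast
    then show ?thesis unfolding w_def slice_comb_quat_basis by (simp add: d_def)
  qed
  with intr have "is_stem \<Omega> f w" by (simp add: is_stem_def)
  then show ?thesis by (rule that)
qed

section \<open>Slice preserving functions and components\<close>

lemma slice_preserving_stem:
  assumes F: "F \<in> slice_preserving \<Omega>"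
  obtains w where "intrinsic_on (slice_shadow \<Omega>) w"
    "\<And>I z. I \<in> imag_units \<Longrightarrow> z \<in> slice_shadow \<Omega> \<Longrightarrow> F (slice_embed I z) = slice_embed I (w z)"
proof -
  obtain v where v: "is_stem \<Omega> F v"
    using slice_regular_stem F by (auto simp: slice_preserving_def)
  have "v 1 z = 0 \<and> v 2 z = 0 \<and> v 3 z = 0" if z: "z \<in> slice_shadow \<Omega>" for z
  proof -
    have "slice_comb I (\<lambda>n. v n z) \<in> range (slice_embed I)"
      "slice_comb (- I) (\<lambda>n. v n z) \<in> range (slice_embed I)" if I: "I \<in> imag_units" for I
    proof -
      have "F ` (\<Omega> \<inter> range (slice_embed I)) \<subseteq> range (slice_embed I)"
        using F I by (auto simp: slice_preserving_def slice_plane_eq_range)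
      moreover have "slice_embed I z \<in> \<Omega>" "slice_embed (- I) z \<in> \<Omega>"
        using z I slice_embed_mem_iff[OF \<Omega>] imag_units_uminus by blast+
      moreover have "slice_embed (- I) z \<in> range (slice_embed I)"
        using slice_embed_uminus_cnj[of I "cnj z"] by simp
      ultimately have "F (slice_embed I z) \<in> range (slice_embed I)"
        "F (slice_embed (- I) z) \<in> range (slice_embed I)" by blast+
      then show "slice_comb I (\<lambda>n. v n z) \<in> range (slice_embed I)"
        "slice_comb (- I) (\<lambda>n. v n z) \<in> range (slice_embed I)"
        using is_stemD(2)[OF v] I z imag_units_uminus by auto
    qed
    \<comment> \<open>The slice of \<open>quat_i\<close> excludes the entries 2 and 3, that of
      \<open>quat_j\<close> the entries 1 and 3.\<close>
    from this[of quat_i] this[of quat_j] show ?thesis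
      unfolding slice_comb_split by (auto simp: quat_eq_iff complex_eq_iff)
  qed
  then have "F (slice_embed I z) = slice_embed I (v 0 z)" if "I \<in> imag_units" "z \<in> slice_shadow \<Omega>" for I z
    using is_stemD(2)[OF v] that by (simp add: slice_comb_def)
  then show ?thesis using that is_stemD(1)[OF v, of 0] by simp
qed

lemma slice_lift_slice_preserving:
  assumes w: "intrinsic_on (slice_shadow \<Omega>) w"
  shows "slice_lift w \<in> slice_preserving \<Omega>"
proof -
  have "is_stem \<Omega> (slice_lift w) (\<lambda>n. if n = 0 then w else (\<lambda>z. of_real 0))"
    using w slice_lift_slice_embed[OF w]
    by (auto simp: is_stem_def slice_comb_def intro: intrinsic_on_of_real[of _ 0, simplified])
  then have "slice_lift w \<in> slice_regular \<Omega>" by (rule slice_regular_is_stem)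
  moreover have "slice_lift w ` (\<Omega> \<inter> slice_plane I) \<subseteq> slice_plane I" if I: "I \<in> imag_units" for I
    using slice_lift_slice_embed[OF w I] slice_embed_mem_iff[OF \<Omega> I]
    by (auto simp: slice_plane_eq_range)
  ultimately show ?thesis by (simp add: slice_preserving_def)
qed

text \<open>The lifts of the stem entries show that the choice in \<open>slice_component\<close>
  succeeds. The chosen components have stems of their own, which together form a stem of
  \<open>f\<close>; uniqueness of stems identifies them with \<open>w\<close>.\<close>

lemma slice_component_stem:
  assumes w: "is_stem \<Omega> f w" and "n \<le> 3" "I \<in> imag_units" "z \<in> slice_shadow \<Omega>"
  shows "slice_component \<Omega> f n (slice_embed I z) = slice_embed I (w n z)"
proof -
  let ?F = "slice_component \<Omega> f"
  have lift: "slice_lift (w n) (slice_embed I z) = slice_embed I (w n z)"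
    if "n \<le> 3" "I \<in> imag_units" "z \<in> slice_shadow \<Omega>" for n I z
    using is_stemD(1)[OF w] slice_lift_slice_embed that by blast
  have "is_slice_components \<Omega> f (\<lambda>n. slice_lift (w n))"
    unfolding is_slice_components_def
  proof (intro conjI allI impI ballI)
    fix q assume "q \<in> \<Omega>"
    then obtain I z where "I \<in> imag_units" "z \<in> slice_shadow \<Omega>" "q = slice_embed I z"
      by (rule slice_shadow_obtain[OF \<Omega>])
    then show "f q = slice_lift (w 0) q + slice_lift (w 1) q * quat_i
        + slice_lift (w 2) q * quat_j + slice_lift (w 3) q * quat_k"
      using is_stemD(2)[OF w] lift by (simp add: slice_comb_def)
  qed (use is_stemD(1)[OF w] slice_lift_slice_preserving in blast)
  then have F: "is_slice_components \<Omega> f ?F"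
    unfolding slice_component_def by (rule someI[where P = "is_slice_components \<Omega> f"])
  then have "\<forall>n\<in>{..3}. \<exists>v. intrinsic_on (slice_shadow \<Omega>) v \<and>
      (\<forall>I\<in>imag_units. \<forall>z\<in>slice_shadow \<Omega>. ?F n (slice_embed I z) = slice_embed I (v z))"
    unfolding is_slice_components_def by (metis atMost_iff slice_preserving_stem)
  then obtain v where v: "\<And>n. n \<le> 3 \<Longrightarrow> intrinsic_on (slice_shadow \<Omega>) (v n)"
    "\<And>n I z. n \<le> 3 \<Longrightarrow> I \<in> imag_units \<Longrightarrow> z \<in> slice_shadow \<Omega> \<Longrightarrow>
      ?F n (slice_embed I z) = slice_embed I (v n z)"
    unfolding Ball_def atMost_iff by metis
  have "is_stem \<Omega> f v"
    using v F slice_embed_mem_iff[OF \<Omega>]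
    by (simp add: is_stem_def slice_comb_def is_slice_components_def)
  then show ?thesis
    using v(2) is_stem_unique[OF w] assms by simp
qed

end

section \<open>The complexified quaternions\<close>

definition cquat_mult :: "(nat \<Rightarrow> complex) \<Rightarrow> (nat \<Rightarrow> complex) \<Rightarrow> nat \<Rightarrow> complex" where
  "cquat_mult a b n =
     (if n = 0 then a 0 * b 0 - a 1 * b 1 - a 2 * b 2 - a 3 * b 3
      else if n = 1 then a 0 * b 1 + b 0 * a 1 + (a 2 * b 3 - a 3 * b 2)
      else if n = 2 then a 0 * b 2 + b 0 * a 2 + (a 3 * b 1 - a 1 * b 3)
      else a 0 * b 3 + b 0 * a 3 + (a 1 * b 2 - a 2 * b 1))"

definition cquat_conj :: "(nat \<Rightarrow> complex) \<Rightarrow> nat \<Rightarrow> complex" where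
  "cquat_conj a n = (if n = 0 then a 0 else - a n)"

definition cquat_of :: "quat \<Rightarrow> nat \<Rightarrow> complex" where
  "cquat_of q n = of_real (if n = 0 then Re0 q else if n = 1 then Im1 q else if n = 2 then Im2 q else Im3 q)"

context
  fixes \<Omega> :: "quat set"
  assumes \<Omega>: "symmetric_slice_domain \<Omega>"
begin

lemma is_stem_const: "is_stem \<Omega> (\<lambda>_. q) (\<lambda>n z. cquat_of q n)"
  unfolding is_stem_def
  by (auto simp: cquat_of_def intrinsic_on_of_real slice_comb_split quat_eq_iff)

lemma is_stem_regular_conj:
  assumes "is_stem \<Omega> f u"
  shows "is_stem \<Omega> (regular_conj \<Omega> f) (\<lambda>n z. cquat_conj (\<lambda>m. u m z) n)"
  unfolding is_stem_def
proof (intro conjI allI impI ballI)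
  fix n :: nat assume "n \<le> 3"
  then show "intrinsic_on (slice_shadow \<Omega>) (\<lambda>z. cquat_conj (\<lambda>m. u m z) n)"
    using is_stemD(1)[OF assms] unfolding cquat_conj_def by (intro intrinsic_on_if intrinsic_on_uminus) simp_all
next
  fix I z assume "I \<in> imag_units" "z \<in> slice_shadow \<Omega>"
  then show "regular_conj \<Omega> f (slice_embed I z) = slice_comb I (cquat_conj (\<lambda>m. u m z))"
    using slice_component_stem[OF \<Omega> assms]
    by (simp add: regular_conj_def Let_def slice_comb_def cquat_conj_def slice_embed_linear)
qed

text \<open>\<open>slice_embed I\<close> is an algebra homomorphism, and the components take values
  in its commutative image, so the pointwise formula passes to the stem entries.\<close>

lemma is_stem_star_prod:
  assumes "is_stem \<Omega> f u" "is_stem \<Omega> g v"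
  shows "is_stem \<Omega> (star_prod \<Omega> f g) (\<lambda>n z. cquat_mult (\<lambda>m. u m z) (\<lambda>m. v m z) n)"
  unfolding is_stem_def
proof (intro conjI allI impI ballI)
  fix n :: nat assume "n \<le> 3"
  then show "intrinsic_on (slice_shadow \<Omega>) (\<lambda>z. cquat_mult (\<lambda>m. u m z) (\<lambda>m. v m z) n)"
    using is_stemD(1)[OF assms(1)] is_stemD(1)[OF assms(2)]
    unfolding cquat_mult_def by (intro intrinsic_on_if intrinsic_on_intros) simp_all
next
  fix I z assume "I \<in> imag_units" "z \<in> slice_shadow \<Omega>"
  then show "star_prod \<Omega> f g (slice_embed I z) =
      slice_comb I (cquat_mult (\<lambda>m. u m z) (\<lambda>m. v m z))"
    using slice_component_stem[OF \<Omega> assms(1)] slice_component_stem[OF \<Omega> assms(2)]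
    by (simp add: star_prod_def Let_def slice_comb_def cquat_mult_def slice_embed_linear slice_embed_mult)
      (simp add: algebra_simps)
qed

text \<open>The component of index 0 is read off from the stem entry 0, and
  \<open>slice_embed I\<close> is injective.\<close>

lemma star_inner_eq_zero_iff:
  assumes "is_stem \<Omega> f u" "is_stem \<Omega> g v"
  shows "(\<forall>q\<in>\<Omega>. star_inner \<Omega> f g q = 0) \<longleftrightarrow>
    (\<forall>z\<in>slice_shadow \<Omega>. cquat_mult (\<lambda>m. u m z) (cquat_conj (\<lambda>m. v m z)) 0 = 0)"
proof -
  have "star_inner \<Omega> f g (slice_embed I z) =
      slice_embed I (cquat_mult (\<lambda>m. u m z) (cquat_conj (\<lambda>m. v m z)) 0)"
    if "I \<in> imag_units" "z \<in> slice_shadow \<Omega>" for I z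
    unfolding star_inner_def
    using slice_component_stem[OF \<Omega> is_stem_star_prod[OF assms(1) is_stem_regular_conj[OF assms(2)]]]
      that by simp
  moreover have "slice_embed I c = 0 \<longleftrightarrow> c = 0" if "I \<in> imag_units" for I c
    using that
    by (auto simp: slice_embed_scaleR imag_units_iff quat_eq_iff complex_eq_iff)
  ultimately show ?thesis
    using slice_shadow_obtain[OF \<Omega>] slice_embed_mem_iff[OF \<Omega>] quat_unit_imag_units(1) by metis
qed

end

section \<open>Membership in a slice plane as an orthogonality condition\<close>

lemma slice_plane_iff_orthogonal:
  assumes I: "I \<in> imag_units"
  shows "q \<in> slice_plane I \<longleftrightarrow> (\<forall>M\<in>imag_units. orthogonal M I \<longrightarrow> inner q M = 0)"
proof
  assume "q \<in> slice_plane I"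
  then obtain z where "q = slice_embed I z" by (auto simp: slice_plane_eq_range)
  then show "\<forall>M\<in>imag_units. orthogonal M I \<longrightarrow> inner q M = 0"
    by (auto simp: slice_embed_scaleR inner_add_left orthogonal_def inner_commute[of I])
      (simp add: inner_quat_def imag_units_iff)
next
  assume R: "\<forall>M\<in>imag_units. orthogonal M I \<longrightarrow> inner q M = 0"
  \<comment> \<open>\<open>slice_embed I z\<close> is the orthogonal projection of \<open>q\<close>
    to the slice plane. The remainder \<open>p\<close> is imaginary and orthogonal to
    \<open>I\<close>, so unless it vanishes its normalization is an admissible \<open>M\<close>, and
    testing against it gives a contradiction.\<close>
  define z where "z = Complex (Re0 q) (inner q I)"
  define p where "p = q - slice_embed I z"
  have II: "inner I I = 1" using norm_imag_units[OF I] by (simp add: norm_eq_1)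
  have 1: "inner 1 I = 0" using I by (simp add: inner_quat_def imag_units_iff)
  have pI: "inner p I = 0"
    by (simp add: p_def z_def slice_embed_scaleR inner_diff_left inner_add_left II 1)
  have p1: "Re0 p = 0" using I by (simp add: p_def z_def)
  have "p = 0"
  proof (rule ccontr)
    assume "p \<noteq> 0"
    then have "norm (sgn p) = 1" by (simp add: norm_sgn)
    moreover have "Re0 (sgn p) = 0" by (simp add: sgn_div_norm p1)
    ultimately have "sgn p \<in> imag_units"
      by (simp add: imag_units_iff norm_quat_def inner_quat_def power2_eq_square)
    moreover have "orthogonal (sgn p) I" by (simp add: orthogonal_def sgn_div_norm pI)
    ultimately have "inner q (sgn p) = 0" using R by blast
    then have "inner q p = 0" using \<open>p \<noteq> 0\<close> by (simp add: sgn_div_norm)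
    moreover have "inner (slice_embed I z) p = 0"
      using pI p1 by (simp add: slice_embed_scaleR inner_add_left inner_commute[of I])
        (simp add: inner_quat_def)
    ultimately have "inner p p = 0" by (simp add: p_def inner_diff_left)
    with \<open>p \<noteq> 0\<close> show False by simp
  qed
  then show "q \<in> slice_plane I" by (auto simp: p_def slice_plane_eq_range)
qed

text \<open>The slice plane is stable under left multiplication by \<open>I\<close>, so it contains
  both a + I b and a - I b exactly when it contains a and b. Orthogonality of a and b to
  \<open>M\<close> is the real and the imaginary part of the complex equation.\<close>

lemma slice_comb_in_slice_plane_iff:
  assumes I: "I \<in> imag_units"
  shows "slice_comb I c \<in> slice_plane I \<and> slice_comb (- I) c \<in> slice_plane I \<longleftrightarrow>
    (\<forall>M\<in>imag_units. orthogonal M I \<longrightarrow>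
      c 1 * cquat_of M 1 + c 2 * cquat_of M 2 + c 3 * cquat_of M 3 = 0)"
proof -
  let ?P = "slice_plane I"
  define a where "a = Quat (Re (c 0)) (Re (c 1)) (Re (c 2)) (Re (c 3))"
  define b where "b = Quat (Im (c 0)) (Im (c 1)) (Im (c 2)) (Im (c 3))"
  have P: "subspace ?P" by (simp add: slice_plane_def)
  have mult: "I * x \<in> ?P" if "x \<in> ?P" for x
    using that slice_embed_mult[OF I, of \<i>] by (auto simp: slice_plane_eq_range) (metis rangeI)
  have "a + I * b \<in> ?P \<and> a - I * b \<in> ?P \<longleftrightarrow> a \<in> ?P \<and> b \<in> ?P"
  proof
    assume H: "a + I * b \<in> ?P \<and> a - I * b \<in> ?P"
    have "a = (1/2) *\<^sub>R ((a + I * b) + (a - I * b))" by (simp flip: scaleR_2)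
    moreover have "b = - (I * ((1/2) *\<^sub>R ((a + I * b) - (a - I * b))))"
      by (simp add: imag_units_square_left[OF I] flip: scaleR_2)
    ultimately show "a \<in> ?P \<and> b \<in> ?P"
      using H P mult by (metis subspace_add subspace_diff subspace_scale subspace_neg)
  qed (use P mult in \<open>auto intro: subspace_add subspace_diff\<close>)
  also have "\<dots> \<longleftrightarrow> (\<forall>M\<in>imag_units. orthogonal M I \<longrightarrow> inner a M = 0 \<and> inner b M = 0)"
    by (auto simp: slice_plane_iff_orthogonal[OF I])
  also have "\<dots> \<longleftrightarrow> (\<forall>M\<in>imag_units. orthogonal M I \<longrightarrow>
      c 1 * cquat_of M 1 + c 2 * cquat_of M 2 + c 3 * cquat_of M 3 = 0)"
    by (auto simp: a_def b_def inner_quat_def cquat_of_def complex_eq_iff imag_units_iff)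
  finally show ?thesis by (simp add: slice_comb_split a_def b_def)
qed

text \<open>Both \<open>I\<close> and \<open>- I\<close> embed the shadow into the slice of
  \<open>I\<close>; testing both at each \<open>z\<close> gives the pair of values that
  \<open>slice_comb_in_slice_plane_iff\<close> requires.\<close>

lemma slice_preserving_at_stem_iff:
  assumes \<Omega>: "symmetric_slice_domain \<Omega>" and I: "I \<in> imag_units" and w: "is_stem \<Omega> f w"
  shows "f \<in> slice_preserving_at \<Omega> I \<longleftrightarrow>
    (\<forall>M\<in>imag_units. orthogonal M I \<longrightarrow> (\<forall>z\<in>slice_shadow \<Omega>.
      w 1 z * cquat_of M 1 + w 2 z * cquat_of M 2 + w 3 z * cquat_of M 3 = 0))"
proof -
  have emb: "slice_embed (- I) z \<in> slice_plane I" "slice_embed I z \<in> slice_plane I" for z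
    using slice_embed_uminus_cnj[of I "cnj z"] by (simp_all add: slice_plane_eq_range)
  have "f \<in> slice_preserving_at \<Omega> I \<longleftrightarrow> (\<forall>q\<in>\<Omega> \<inter> slice_plane I. f q \<in> slice_plane I)"
    using slice_regular_is_stem[OF \<Omega> w] by (auto simp: slice_preserving_at_def)
  also have "\<dots> \<longleftrightarrow> (\<forall>z\<in>slice_shadow \<Omega>.
      f (slice_embed I z) \<in> slice_plane I \<and> f (slice_embed (- I) z) \<in> slice_plane I)"
    using emb slice_embed_mem_iff[OF \<Omega>] I imag_units_uminus[OF I]
      slice_plane_obtain[OF \<Omega> _ _ I] by (metis IntD1 IntD2 IntI)
  also have "\<dots> \<longleftrightarrow> (\<forall>z\<in>slice_shadow \<Omega>. slice_comb I (\<lambda>n. w n z) \<in> slice_plane I \<and>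
      slice_comb (- I) (\<lambda>n. w n z) \<in> slice_plane I)"
    using is_stemD(2)[OF w] I imag_units_uminus[OF I] by simp
  finally show ?thesis
    unfolding slice_comb_in_slice_plane_iff[OF I] by blast
qed

text \<open>Conjugation reverses products and negates the imaginary \<open>m\<close>, so the left
  side is minus the scalar part of a b m.\<close>

lemma cquat_mult_conj_left:
  assumes "m 0 = 0"
  shows "cquat_mult a (cquat_conj (cquat_mult m (cquat_conj b))) 0 =
    cquat_mult a b 1 * m 1 + cquat_mult a b 2 * m 2 + cquat_mult a b 3 * m 3"
  using assms by (simp add: cquat_mult_def cquat_conj_def algebra_simps)

text \<open>Here the left side is the scalar part of the conjugate of b m a, which by cyclicity is
  that of a b m; hence the opposite sign.\<close>

lemma cquat_mult_conj_right:
  assumes "m 0 = 0"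
  shows "cquat_mult (cquat_conj a) (cquat_conj (cquat_mult b m)) 0 =
    - (cquat_mult a b 1 * m 1 + cquat_mult a b 2 * m 2 + cquat_mult a b 3 * m 3)"
  using assms by (simp add: cquat_mult_def cquat_conj_def algebra_simps)

theorem proposition4p5:
  fixes \<Omega> :: "quat set" and I\<^sub>0 :: quat and f g :: "quat \<Rightarrow> quat"
  assumes "symmetric_slice_domain \<Omega>"
    and "I\<^sub>0 \<in> imag_units"
    and "f \<in> slice_regular \<Omega>" and "g \<in> slice_regular \<Omega>"
  shows "(star_prod \<Omega> f g \<in> slice_preserving_at \<Omega> I\<^sub>0 \<longleftrightarrow>
           (\<forall>M\<^sub>0\<in>imag_units. orthogonal M\<^sub>0 I\<^sub>0 \<longrightarrow>
             (\<forall>q\<in>\<Omega>. star_inner \<Omega> f (star_prod \<Omega> (\<lambda>_. M\<^sub>0) (regular_conj \<Omega> g)) q = 0)))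
       \<and> (star_prod \<Omega> f g \<in> slice_preserving_at \<Omega> I\<^sub>0 \<longleftrightarrow>
           (\<forall>M\<^sub>0\<in>imag_units. orthogonal M\<^sub>0 I\<^sub>0 \<longrightarrow>
             (\<forall>q\<in>\<Omega>. star_inner \<Omega> (regular_conj \<Omega> f) (star_prod \<Omega> g (\<lambda>_. M\<^sub>0)) q = 0)))"
proof -
  obtain u v where u: "is_stem \<Omega> f u" and v: "is_stem \<Omega> g v"
    using slice_regular_stem[OF assms(1)] assms(3,4) by metis
  note fg = slice_preserving_at_stem_iff[OF assms(1,2) is_stem_star_prod[OF assms(1) u v]]
  have M0: "cquat_of M 0 = 0" if "M \<in> imag_units" for M
    using that by (simp add: cquat_of_def imag_units_iff)
  have ii: "(\<forall>q\<in>\<Omega>. star_inner \<Omega> f (star_prod \<Omega> (\<lambda>_. M) (regular_conj \<Omega> g)) q = 0) \<longleftrightarrow>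
      (\<forall>z\<in>slice_shadow \<Omega>. cquat_mult (\<lambda>m. u m z) (\<lambda>m. v m z) 1 * cquat_of M 1
        + cquat_mult (\<lambda>m. u m z) (\<lambda>m. v m z) 2 * cquat_of M 2
        + cquat_mult (\<lambda>m. u m z) (\<lambda>m. v m z) 3 * cquat_of M 3 = 0)"
    if "M \<in> imag_units" for M
    using star_inner_eq_zero_iff[OF assms(1) u
        is_stem_star_prod[OF assms(1) is_stem_const[OF assms(1)] is_stem_regular_conj[OF assms(1) v]]]
    by (simp add: cquat_mult_conj_left[of "cquat_of M", OF M0[OF that]])
  have iii: "(\<forall>q\<in>\<Omega>. star_inner \<Omega> (regular_conj \<Omega> f) (star_prod \<Omega> g (\<lambda>_. M)) q = 0) \<longleftrightarrow>
      (\<forall>z\<in>slice_shadow \<Omega>. cquat_mult (\<lambda>m. u m z) (\<lambda>m. v m z) 1 * cquat_of M 1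
        + cquat_mult (\<lambda>m. u m z) (\<lambda>m. v m z) 2 * cquat_of M 2
        + cquat_mult (\<lambda>m. u m z) (\<lambda>m. v m z) 3 * cquat_of M 3 = 0)"
    if "M \<in> imag_units" for M
    using star_inner_eq_zero_iff[OF assms(1) is_stem_regular_conj[OF assms(1) u]
        is_stem_star_prod[OF assms(1) v is_stem_const[OF assms(1)]]]
    by (simp only: cquat_mult_conj_right[of "cquat_of M", OF M0[OF that]] neg_equal_0_iff_equal)
  \<comment> \<open>All three conditions are now the vanishing of the same three-term sum for every
    admissible \<open>M\<close> and every point of the shadow.\<close>
  from fg ii iii show ?thesis by auto
qed

end
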